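(* Let $\{A(t)\}_{t\ge 0}$ be a continuous time chain of $N\times N$ matrices and let $t_0\ge 0$. For the opinion network $\dot x(t)=A(t)x(t)$, $t\ge t_0$, the size of the smallest Éminence Grise Coalition (EGC) is $\mathbf{rank}(A)$.
   Context: Let $N\ge 1$ and $\mathcal V=\{1,\dots,N\}$. A continuous time chain $\{A(t)\}_{t\ge0}$ is a family of real $N\times N$ matrices with zero row sums and non-negative off-diagonal entries, whose entries are measurable and locally integrable functions of $t\in[0,\infty)$. Let $\Phi(t,\tau)$, $t\ge\tau\ge0$, be its state transition matrix, so solutions satisfy $x(t)=\Phi(t,\tau)x(\tau)$; it is invertible and row-stochastic. EGC: for the network with initial time $t_0$, a subset $\mathcal S\subset\mathcal V$ is an EGC if for every $x^*\in\mathbb R$ and every choice of initial values $x_i(t_0)$, $i\in\mathcal V\setminus\mathcal S$, there is a choice of initial values $x_i(t_0)$, $i\in\mathcal S$, such that $\lim_{t\to\infty}x(t)=x^*\mathbf 1_N$, where $\mathbf 1_N$ is the all-ones vector. Rank: for $\tau\ge0$ let $\mathbf{null}_\tau(A)=\{v\in\mathbb R^N : \lim_{t\to\infty}\Phi(t,\tau)v=\mathbf 0_N\}$. This is a vector space whose dimension does not depend on $\tau$; this dimension is $\mathbf{nullity}(A)$, and $\mathbf{rank}(A)=N-\mathbf{nullity}(A)$. *)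

theory Defs
  imports "HOL-Analysis.Analysis"
begin

text \<open>
  The vertex set \<open>{1,\<dots>,N}\<close> is a finite type \<open>'n\<close>, with \<open>N = CARD('n)\<close>.
  Chains are functions on all of \<open>real\<close>; only their values at times \<open>t \<ge> 0\<close> matter.
\<close>

text \<open>Absolute (Lebesgue) integrability on \<open>{0..T}\<close> for all \<open>T\<close> includes measurability on
  \<open>[0,\<infinity>)\<close>.\<close>

definition ct_chain :: "(real \<Rightarrow> real ^ 'n ^ 'n) \<Rightarrow> bool" where
  "ct_chain A \<longleftrightarrow>
     (\<forall>t\<ge>0. \<forall>i. (\<Sum>j\<in>UNIV. A t $ i $ j) = 0) \<and>
     (\<forall>t\<ge>0. \<forall>i j. i \<noteq> j \<longrightarrow> A t $ i $ j \<ge> 0) \<and>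
     (\<forall>i j. \<forall>T\<ge>0. (\<lambda>t. A t $ i $ j) absolutely_integrable_on {0..T})"

text \<open>
  As \<open>A\<close> is only locally integrable, \<open>x' = A x\<close> on \<open>[\<tau>,\<infinity>)\<close> is understood in the sense of
  Caratheodory, in integral form.  A function satisfying the condition below is continuous on
  \<open>[\<tau>,\<infinity>)\<close>, being an indefinite integral, so for a chain the integrand is also
  Lebesgue integrable and the two integrals agree.
\<close>

definition network_solution ::
    "(real \<Rightarrow> real ^ 'n ^ 'n) \<Rightarrow> real \<Rightarrow> (real \<Rightarrow> real ^ 'n) \<Rightarrow> bool" where
  "network_solution A \<tau> x \<longleftrightarrow>
     (\<forall>t\<ge>\<tau>. ((\<lambda>s. A s *v x s) has_integral (x t - x \<tau>)) {\<tau>..t})"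

definition fundamental_solution ::
    "(real \<Rightarrow> real ^ 'n ^ 'n) \<Rightarrow> real \<Rightarrow> (real \<Rightarrow> real ^ 'n ^ 'n) \<Rightarrow> bool" where
  "fundamental_solution A \<tau> X \<longleftrightarrow>
     X \<tau> = mat 1 \<and>
     (\<forall>t\<ge>\<tau>. ((\<lambda>s. A s ** X s) has_integral (X t - X \<tau>)) {\<tau>..t})"

text \<open>For a chain and \<open>t \<ge> \<tau> \<ge> 0\<close> the fundamental solution exists and its value at \<open>t\<close> is unique.\<close>

definition transition_matrix ::
    "(real \<Rightarrow> real ^ 'n ^ 'n) \<Rightarrow> real \<Rightarrow> real \<Rightarrow> real ^ 'n ^ 'n" where
  "transition_matrix A t \<tau> = (THE M. \<exists>X. fundamental_solution A \<tau> X \<and> X t = M)"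

definition is_EGC :: "(real \<Rightarrow> real ^ 'n ^ 'n) \<Rightarrow> real \<Rightarrow> 'n set \<Rightarrow> bool" where
  "is_EGC A t0 S \<longleftrightarrow>
     (\<forall>c::real. \<forall>y::real ^ 'n. \<exists>x. network_solution A t0 x \<and>
        (\<forall>i. i \<notin> S \<longrightarrow> x t0 $ i = y $ i) \<and>
        (x \<longlongrightarrow> (\<chi> i. c)) at_top)"

definition null_at :: "(real \<Rightarrow> real ^ 'n ^ 'n) \<Rightarrow> real \<Rightarrow> (real ^ 'n) set" where
  "null_at A \<tau> = {v. ((\<lambda>t. transition_matrix A t \<tau> *v v) \<longlongrightarrow> 0) at_top}"

text \<open>For a chain, the dimension of \<open>null_at A \<tau>\<close> is the same for all \<open>\<tau> \<ge> 0\<close>, since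
  transition matrices are invertible; time \<open>0\<close> serves as the reference.\<close>

definition chain_nullity :: "(real \<Rightarrow> real ^ 'n ^ 'n) \<Rightarrow> nat" where
  "chain_nullity A = dim (null_at A 0)"

definition chain_rank :: "(real \<Rightarrow> real ^ 'n ^ 'n) \<Rightarrow> nat" where
  "chain_rank A = CARD('n) - chain_nullity A"

end

theory Submission
  imports Defs
begin

text \<open>
  Consensus vectors are stationary solutions because the row sums vanish, so by linearity \<open>S\<close> is
  an EGC iff the space \<open>V\<close> of initial values at \<open>t0\<close> whose solution tends to \<open>0\<close> projects onto
  the coordinates outside \<open>S\<close>, i.e. iff \<open>V\<close> and the axes of \<open>S\<close> together span \<open>\<real>\<^sup>N\<close>.  The smallest
  such \<open>S\<close> has \<open>N - dim V\<close> elements, by extending a basis of \<open>V\<close> with axis vectors.  Finally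
  \<open>V\<close> is the image of \<open>null_at A 0\<close> under the flow from \<open>0\<close> to \<open>t0\<close>, which is a linear
  isomorphism since solutions through a point are unique forwards and backwards in time.
\<close>

section \<open>Subspaces projecting onto coordinates\<close>

lemma spanning_axes: "span (range (\<lambda>i::'n::finite. axis i (1::real))) = UNIV"
proof -
  have "Basis = range (\<lambda>i::'n. axis i (1::real))"
    by (auto simp: Basis_vec_def)
  then show ?thesis using span_Basis by metis
qed

lemma span_axes_vanishing:
  assumes "v \<in> span ((\<lambda>i. axis i (1::real)) ` S)" "i \<notin> S"
  shows "v $ i = 0"
  using assms(1)
proof (induction rule: span_induct_alt)
  case (step c x y)
  then show ?case using assms(2) by (auto simp: axis_def split: if_splits)
qed simp

text \<open>Subtracting from \<open>y\<close> an element of \<open>V\<close> that agrees with it off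
  \<open>S\<close> leaves a vector supported on \<open>S\<close>. So a basis of \<open>V\<close> and
  the axes of \<open>S\<close> together span the whole space, and counting this spanning set gives
  the bound.\<close>

lemma dim_complement_coordinates_le:
  fixes V :: "(real ^ 'n) set"
  assumes "\<And>y. \<exists>v\<in>V. \<forall>i. i \<notin> S \<longrightarrow> v $ i = y $ i"
  shows "CARD('n) - dim V \<le> card S"
proof -
  obtain B where B: "B \<subseteq> V" "independent B" "V \<subseteq> span B" "card B = dim V"
    using basis_exists by blast
  let ?E = "(\<lambda>i. axis i (1::real)) ` S"
  have "y \<in> span (B \<union> ?E)" for y :: "real ^ 'n"
  proof -
    obtain v where v: "v \<in> V" "\<And>i. i \<notin> S \<Longrightarrow> v $ i = y $ i"
      using assms[of y] by blast
    have "y - v = (\<Sum>i\<in>UNIV. (y - v) $ i *s axis i 1)"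
      by (rule basis_expansion[symmetric])
    also have "\<dots> = (\<Sum>i\<in>S. (y - v) $ i *s axis i 1)"
      by (rule sum.mono_neutral_right) (auto simp: v)
    also have "\<dots> \<in> span ?E"
      unfolding scalar_mult_eq_scaleR by (intro span_sum span_scale span_base) auto
    finally have "y - v \<in> span (B \<union> ?E)"
      using span_mono[of ?E "B \<union> ?E"] by blast
    moreover have "v \<in> span (B \<union> ?E)"
      using v(1) B(3) span_mono[of B "B \<union> ?E"] by blast
    ultimately show ?thesis
      using span_add by fastforce
  qed
  then have "dim (UNIV :: (real ^ 'n) set) \<le> card (B \<union> ?E)"
    using independent_imp_finite[OF B(2)] by (intro dim_le_card) auto
  also have "\<dots> \<le> card B + card ?E"
    by (rule card_Un_le)
  also have "card ?E \<le> card S"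
    by (rule card_image_le) simp
  finally show ?thesis
    using B(4) by simp
qed

text \<open>Steinitz exchange: a basis \<open>B\<close> of \<open>V\<close> grows to a basis of the
  whole space by adding axis vectors only. Splitting \<open>y\<close> along \<open>B\<close> and the
  added axes yields the required element of \<open>V\<close>, since the second summand vanishes off
  \<open>S\<close>.\<close>

lemma complement_coordinates_exist:
  fixes V :: "(real ^ 'n) set"
  assumes "subspace V"
  obtains S where "card S = CARD('n) - dim V" "\<And>y. \<exists>v\<in>V. \<forall>i. i \<notin> S \<longrightarrow> v $ i = y $ i"
proof -
  obtain B where B: "B \<subseteq> V" "independent B" "V \<subseteq> span B" "card B = dim V"
    using basis_exists by blast
  let ?e = "\<lambda>i::'n. axis i (1::real)"
  obtain C where C: "B \<subseteq> C" "C \<subseteq> B \<union> range ?e" "independent C" "B \<union> range ?e \<subseteq> span C"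
    using maximal_independent_subset_extend[of B "B \<union> range ?e"] B(2) by blast
  have spanC: "span C = UNIV"
    using C(4) span_mono[of "range ?e" "span C"] spanning_axes
    by (metis Un_subset_iff span_span top.extremum_unique)
  \<comment> \<open>Axis vectors already in \<open>B\<close> are left out, so that
    \<open>card S\<close> is exactly the number of vectors added to \<open>B\<close>.\<close>
  define S where "S = {i. ?e i \<in> C - B}"
  have CB: "C - B = ?e ` S"
    using C(2) by (auto simp: S_def)
  have "inj ?e"
    by (auto simp: inj_def axis_eq_axis)
  then have "card S = card (C - B)"
    by (simp add: CB card_image inj_on_subset)
  also have "\<dots> = card C - card B"
    by (rule card_Diff_subset) (use C(1) independent_imp_finite[OF B(2)] in auto)
  also have "card C = CARD('n)"
    using dim_span_eq_card_independent[OF C(3)] spanC by simp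
  finally have "card S = CARD('n) - dim V"
    using B(4) by simp
  moreover have "\<exists>v\<in>V. \<forall>i. i \<notin> S \<longrightarrow> v $ i = y $ i" for y
  proof -
    have "y \<in> span (B \<union> ?e ` S)"
      using spanC C(1) CB by (metis Diff_partition UNIV_I)
    then obtain v w where vw: "v \<in> span B" "w \<in> span (?e ` S)" "y = v + w"
      unfolding span_Un by blast
    have "v \<in> V"
      using vw(1) B(1) assms span_minimal by blast
    moreover have "v $ i = y $ i" if "i \<notin> S" for i
      using span_axes_vanishing[OF vw(2) that] vw(3) by simp
    ultimately show ?thesis by blast
  qed
  ultimately show ?thesis by (rule that)
qed

section \<open>Linear Caratheodory equations\<close>

text \<open>The norm of \<open>M\<close> is the Euclidean norm of its entries (Frobenius norm), so
  Cauchy-Schwarz on each row suffices.\<close>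

lemma norm_matrix_vector_mult_le:
  fixes M :: "real ^ 'n ^ 'm"
  shows "norm (M *v x) \<le> norm M * norm x"
proof -
  have "norm (M *v x) = L2_set (\<lambda>i. norm ((M *v x) $ i)) UNIV"
    by (simp add: norm_vec_def)
  also have "\<dots> \<le> L2_set (\<lambda>i. norm (M $ i) * norm x) UNIV"
    by (rule L2_set_mono) (simp_all add: matrix_vector_mul_component Cauchy_Schwarz_ineq2)
  also have "\<dots> = norm M * norm x"
    by (simp add: norm_vec_def[of M] L2_set_left_distrib)
  finally show ?thesis .
qed

section \<open>Solutions on compact intervals: superposition, restriction and gluing\<close>

definition solution_on ::
    "(real \<Rightarrow> real ^ 'n ^ 'n) \<Rightarrow> real \<Rightarrow> real \<Rightarrow> (real \<Rightarrow> real ^ 'n) \<Rightarrow> bool" where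
  "solution_on A a b x \<longleftrightarrow>
     (\<forall>t\<in>{a..b}. ((\<lambda>s. A s *v x s) has_integral (x t - x a)) {a..t})"

text \<open>For \<open>b < a\<close> the interval is empty and \<open>solution_on\<close> holds
  vacuously, so \<open>b\<close> can range over all reals.\<close>

lemma network_solution_iff: "network_solution A a x \<longleftrightarrow> (\<forall>b. solution_on A a b x)"
  unfolding network_solution_def solution_on_def by (meson atLeastAtMost_iff order_refl)

lemma solution_on_mono: "solution_on A a b x \<Longrightarrow> c \<le> b \<Longrightarrow> solution_on A a c x"
  by (auto simp: solution_on_def)

lemma solution_on_cong:
  assumes "\<And>t. t \<in> {a..b} \<Longrightarrow> x t = y t"
  shows "solution_on A a b x \<longleftrightarrow> solution_on A a b y"
proof -
  have "((\<lambda>s. A s *v x s) has_integral (x t - x a)) {a..t}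
    \<longleftrightarrow> ((\<lambda>s. A s *v y s) has_integral (y t - y a)) {a..t}" if "t \<in> {a..b}" for t
  proof -
    have "x t - x a = y t - y a" using assms that by auto
    then show ?thesis
      using that assms by (auto intro!: has_integral_cong)
  qed
  then show ?thesis
    by (simp add: solution_on_def)
qed

lemma solution_on_linear_combination:
  assumes "solution_on A a b x" "solution_on A a b y"
  shows "solution_on A a b (\<lambda>t. c *\<^sub>R x t + d *\<^sub>R y t)"
  unfolding solution_on_def
proof
  fix t assume "t \<in> {a..b}"
  then have "((\<lambda>s. c *\<^sub>R (A s *v x s) + d *\<^sub>R (A s *v y s))
      has_integral (c *\<^sub>R (x t - x a) + d *\<^sub>R (y t - y a))) {a..t}"
    using assms unfolding solution_on_def
    by (intro has_integral_add has_integral_cmul) auto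
  then show "((\<lambda>s. A s *v (c *\<^sub>R x s + d *\<^sub>R y s))
      has_integral (c *\<^sub>R x t + d *\<^sub>R y t - (c *\<^sub>R x a + d *\<^sub>R y a))) {a..t}"
    by (simp add: matrix_vector_right_distrib matrix_vector_mult_scaleR algebra_simps)
qed

lemma network_solution_linear_combination:
  assumes "network_solution A a x" "network_solution A a y"
  shows "network_solution A a (\<lambda>t. c *\<^sub>R x t + d *\<^sub>R y t)"
  using assms by (simp add: network_solution_iff solution_on_linear_combination)

text \<open>The integral form carries its own regularity: on the interval, \<open>x\<close> equals a
  constant plus an indefinite integral.\<close>

lemma solution_on_continuous:
  assumes "solution_on A a b x"
  shows "continuous_on {a..b} x"
proof (cases "a \<le> b")
  case True
  then have "(\<lambda>s. A s *v x s) integrable_on {a..b}"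
    using assms unfolding solution_on_def by auto
  then have "continuous_on {a..b} (\<lambda>t. x a + integral {a..t} (\<lambda>s. A s *v x s))"
    by (intro continuous_intros indefinite_integral_continuous_1)
  moreover have "x a + integral {a..t} (\<lambda>s. A s *v x s) = x t" if "t \<in> {a..b}" for t
  proof -
    have "integral {a..t} (\<lambda>s. A s *v x s) = x t - x a"
      by (rule integral_unique) (use assms that in \<open>simp add: solution_on_def\<close>)
    then show ?thesis by simp
  qed
  ultimately show ?thesis
    by (rule continuous_on_eq)
qed simp

lemma solution_on_later_start:
  assumes "solution_on A a b x" "a \<le> c"
  shows "solution_on A c b x"
  unfolding solution_on_def
proof
  fix t assume t: "t \<in> {c..b}"
  have 1: "((\<lambda>s. A s *v x s) has_integral (x c - x a)) {a..c}"
    and 2: "((\<lambda>s. A s *v x s) has_integral (x t - x a)) {a..t}"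
    using assms t by (auto simp: solution_on_def)
  have "(\<lambda>s. A s *v x s) integrable_on {c..t}"
    by (rule integrable_subinterval_real[OF has_integral_integrable[OF 2]]) (use assms in auto)
  then obtain i where i: "((\<lambda>s. A s *v x s) has_integral i) {c..t}"
    by blast
  have "x c - x a + i = x t - x a"
    using has_integral_unique[OF has_integral_combine[OF _ _ 1 i] 2] assms t by auto
  then have "i = x t - x c"
    by (simp add: algebra_simps)
  then show "((\<lambda>s. A s *v x s) has_integral (x t - x c)) {c..t}"
    using i by simp
qed

lemma solution_on_join:
  assumes "solution_on A a b x" "solution_on A b c x" "a \<le> b"
  shows "solution_on A a c x"
  unfolding solution_on_def
proof
  fix t assume t: "t \<in> {a..c}"
  show "((\<lambda>s. A s *v x s) has_integral (x t - x a)) {a..t}"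
  proof (cases "t \<le> b")
    case True
    then show ?thesis using assms t by (auto simp: solution_on_def)
  next
    case False
    have "((\<lambda>s. A s *v x s) has_integral (x b - x a) + (x t - x b)) {a..t}"
      by (rule has_integral_combine[of a b]) (use assms t False in \<open>auto simp: solution_on_def\<close>)
    then show ?thesis by simp
  qed
qed

section \<open>Locally integrable systems: integral bounds, uniqueness and existence\<close>

locale locally_integrable_system =
  fixes A :: "real \<Rightarrow> real ^ 'n ^ 'n"
  assumes locally_integrable: "0 \<le> T \<Longrightarrow> A absolutely_integrable_on {0..T}"
begin

lemma integrable: "0 \<le> a \<Longrightarrow> A absolutely_integrable_on {a..b}"
  \<comment> \<open>For negative \<open>b\<close> the interval \<open>{a..b}\<close> is empty;
    \<open>max b 0\<close> keeps the enclosing interval admissible in that case too.\<close>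
  using locally_integrable[of "max b 0"] by (rule absolutely_integrable_on_subinterval) auto

lemma integrable_norm: "0 \<le> a \<Longrightarrow> (\<lambda>s. norm (A s)) integrable_on {a..b}"
  using integrable absolutely_integrable_on_def by blast

text \<open>On a compact interval \<open>x\<close> is bounded and measurable, and a bounded
  measurable factor preserves absolute integrability.\<close>

lemma integrable_mult:
  assumes "0 \<le> a" "continuous_on {a..b} x"
  shows "(\<lambda>s. A s *v x s) absolutely_integrable_on {a..b}"
proof (rule absolutely_integrable_bounded_measurable_product[where h="\<lambda>v M. M *v v"])
  show "bilinear (\<lambda>v (M :: real ^ 'n ^ 'n). M *v v)"
    by (auto simp: bilinear_def intro!: linearI simp: matrix_vector_mult_add_rdistrib
        matrix_vector_right_distrib matrix_vector_mult_scaleR scaleR_matrix_vector_assoc)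
  show "x \<in> borel_measurable (lebesgue_on {a..b})"
    by (rule continuous_imp_measurable_on_sets_lebesgue) (use assms in auto)
  show "bounded (x ` {a..b})"
    using assms compact_continuous_image compact_imp_bounded by blast
qed (use assms integrable in auto)

text \<open>The estimate behind both uniqueness and existence: the integral of \<open>norm A\<close>
  acts as the Lipschitz constant of the integral operator in the supremum norm.\<close>

lemma norm_integral_mult_le:
  assumes "0 \<le> a" "continuous_on {a..b} x" "\<And>s. s \<in> {a..b} \<Longrightarrow> norm (x s) \<le> M"
  shows "norm (integral {a..b} (\<lambda>s. A s *v x s)) \<le> M * integral {a..b} (\<lambda>s. norm (A s))"
proof -
  have "norm (integral {a..b} (\<lambda>s. A s *v x s)) \<le> integral {a..b} (\<lambda>s. M * norm (A s))"
  proof (rule integral_norm_bound_integral)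
    fix s assume "s \<in> {a..b}"
    then show "norm (A s *v x s) \<le> M * norm (A s)"
      using norm_matrix_vector_mult_le[of "A s" "x s"] assms(3)[of s]
      by (smt (verit) mult.commute mult_left_mono norm_ge_zero)
  qed (use assms integrable_mult integrable_norm in
      \<open>auto simp: absolutely_integrable_on_def intro!: integrable_on_mult_right\<close>)
  then show ?thesis by simp
qed

text \<open>
  Splitting an interval into pieces on which \<open>norm A\<close> has integral at most \<open>1/2\<close>: there the integral
  operator of the equation is a contraction in the supremum norm.
\<close>

lemma interval_induct [consumes 2, case_names trans small]:
  fixes P :: "real \<Rightarrow> real \<Rightarrow> bool"
  assumes "0 \<le> a" "a \<le> b"
    and trans: "\<And>u v w. \<lbrakk>0 \<le> u; u \<le> v; v \<le> w; P u v; P v w\<rbrakk> \<Longrightarrow> P u w"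
    and small: "\<And>u v. \<lbrakk>0 \<le> u; u \<le> v; integral {u..v} (\<lambda>s. norm (A s)) \<le> 1/2\<rbrakk> \<Longrightarrow> P u v"
  shows "P a b"
proof -
  define h where "h t = integral {0..t} (\<lambda>s. norm (A s))" for t
  \<comment> \<open>The extra unit gives room on the right: the short intervals around a point
    \<open>x \<le> b\<close> considered below may end beyond \<open>b\<close>, but before
    \<open>x + 1\<close>.\<close>
  have "continuous_on {0..b+1} h"
    unfolding h_def by (intro indefinite_integral_continuous_1 integrable_norm) auto
  then have "uniformly_continuous_on {0..b+1} h"
    by (simp add: compact_uniformly_continuous)
  then obtain d where d: "d > 0"
    "\<And>u v. u \<in> {0..b+1} \<Longrightarrow> v \<in> {0..b+1} \<Longrightarrow> dist u v < d \<Longrightarrow> dist (h u) (h v) < 1/2"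
    unfolding uniformly_continuous_on_def by (metis half_gt_zero_iff zero_less_one)
  \<comment> \<open>The condition \<open>0 \<le> a\<close> goes into the predicate because Bolzano's
    local case also ranges over intervals that begin left of \<open>a\<close>, possibly at negative
    times.\<close>
  have "0 \<le> a \<longrightarrow> a \<le> b \<longrightarrow> P a b"
    using \<open>a \<le> b\<close>
  proof (induction rule: Bolzano)
    case (trans u v w)
    then show ?case using assms(3)[of u v w] by linarith
  next
    case (local x)
    show ?case
    proof (intro exI conjI allI impI)
      show "min d 1 > 0" using d by simp
    next
      fix u v assume uv: "u \<le> x \<and> x \<le> v \<and> v - u < min d 1" "0 \<le> u" "u \<le> v"
      then have m: "u \<in> {0..b+1}" "v \<in> {0..b+1}" "dist u v < d"
        using local by (auto simp: dist_real_def)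
      have "h u + integral {u..v} (\<lambda>s. norm (A s)) = h v"
        unfolding h_def
        by (intro Henstock_Kurzweil_Integration.integral_combine integrable_norm) (use uv in auto)
      then have "integral {u..v} (\<lambda>s. norm (A s)) \<le> 1/2"
        using d(2)[OF m] unfolding dist_real_def by linarith
      then show "P u v"
        using small uv by auto
    qed
  qed
  then show ?thesis using assms(1,2) by simp
qed

text \<open>Letting the zero \<open>c\<close> lie anywhere in the interval gives uniqueness
  backwards as well as forwards in time. On a short piece, integrating between \<open>c\<close> and
  a maximum point of \<open>norm x\<close> shows that the maximum is at most half of itself.\<close>

lemma solution_zero:
  assumes "0 \<le> a" "a \<le> b" "solution_on A a b x" "c \<in> {a..b}" "x c = 0" "t \<in> {a..b}"
  shows "x t = 0"
proof -
  have "\<forall>x. solution_on A a b x \<longrightarrow> (\<exists>c\<in>{a..b}. x c = 0) \<longrightarrow> (\<forall>t\<in>{a..b}. x t = 0)"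
    using assms(1,2)
  proof (induction rule: interval_induct)
    case (trans u v w)
    show ?case
    proof (intro allI impI)
      fix x assume x: "solution_on A u w x" "\<exists>c\<in>{u..w}. x c = 0"
      have uv: "solution_on A u v x" and vw: "solution_on A v w x"
        by (rule solution_on_mono[OF x(1) trans(3)], rule solution_on_later_start[OF x(1) trans(2)])
      \<comment> \<open>The half containing the zero carries it to the common endpoint
        \<open>v\<close>, from where it spreads to the other half.\<close>
      have "x v = 0"
      proof -
        obtain c where c: "c \<in> {u..w}" "x c = 0" using x(2) by blast
        show ?thesis
        proof (cases "c \<le> v")
          case True
          then have "\<exists>c\<in>{u..v}. x c = 0" using c by auto
          then have "\<forall>t\<in>{u..v}. x t = 0" using trans(4) uv by blast
          then show ?thesis using trans(2) by simp
        next
          case False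
          then have "\<exists>c\<in>{v..w}. x c = 0" using c by auto
          then have "\<forall>t\<in>{v..w}. x t = 0" using trans(5) vw by blast
          then show ?thesis using trans(3) by simp
        qed
      qed
      show "\<forall>t\<in>{u..w}. x t = 0"
      proof -
        have "\<exists>c\<in>{u..v}. x c = 0" "\<exists>c\<in>{v..w}. x c = 0"
          using \<open>x v = 0\<close> trans(2,3) by auto
        then have "\<forall>t\<in>{u..v}. x t = 0" "\<forall>t\<in>{v..w}. x t = 0"
          using trans(4,5) uv vw by blast+
        then show ?thesis
          by auto
      qed
    qed
  next
    case (small u v)
    show ?case
    proof (intro allI impI)
      fix x assume x: "solution_on A u v x" "\<exists>c\<in>{u..v}. x c = 0"
      obtain c where c: "c \<in> {u..v}" "x c = 0" using x(2) by blast
      have cont: "continuous_on {u..v} x"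
        using x(1) by (rule solution_on_continuous)
      then obtain m where m: "m \<in> {u..v}" "\<And>s. s \<in> {u..v} \<Longrightarrow> norm (x s) \<le> norm (x m)"
        using continuous_attains_sup[OF compact_Icc _ continuous_on_norm[OF cont]] c(1)
        by (metis empty_iff)
      have le: "norm (x q - x p) \<le> norm (x m) * (1/2)" if pq: "u \<le> p" "p \<le> q" "q \<le> v" for p q
      proof -
        have "solution_on A p v x"
          using x(1) pq(1) by (rule solution_on_later_start)
        then have "x q - x p = integral {p..q} (\<lambda>s. A s *v x s)"
          unfolding solution_on_def by (intro integral_unique[symmetric]) (use pq in auto)
        also have "norm \<dots> \<le> norm (x m) * integral {p..q} (\<lambda>s. norm (A s))"
        proof (rule norm_integral_mult_le)
          show "continuous_on {p..q} x"
            by (rule continuous_on_subset[OF cont]) (use pq in auto)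
        qed (use pq small(1) m(2) in auto)
        also have "\<dots> \<le> norm (x m) * integral {u..v} (\<lambda>s. norm (A s))"
          by (intro mult_left_mono integral_subset_le integrable_norm) (use pq small(1) in auto)
        also have "\<dots> \<le> norm (x m) * (1/2)"
          using small(3) by (intro mult_left_mono) auto
        finally show ?thesis .
      qed
      \<comment> \<open>As \<open>x c = 0\<close>, the increment between \<open>c\<close> and
        \<open>m\<close> has norm \<open>norm (x m)\<close>, whichever of the two points comes
        first.\<close>
      have "norm (x m) \<le> norm (x m) * (1/2)"
        using le[of c m] le[of m c] c m(1) by (cases "c \<le> m") (simp_all add: norm_minus_commute)
      then have "x m = 0" by simp
      then show "\<forall>t\<in>{u..v}. x t = 0"
        using m(2) by auto
    qed
  qed
  then show ?thesis using assms(3-6) by blast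
qed

lemma solution_unique:
  assumes "0 \<le> a" "solution_on A a b x" "solution_on A a b y"
    and "c \<in> {a..b}" "x c = y c" "t \<in> {a..b}"
  shows "x t = y t"
proof -
  have "solution_on A a b (\<lambda>t. 1 *\<^sub>R x t + (-1) *\<^sub>R y t)"
    by (rule solution_on_linear_combination[OF assms(2,3)])
  from solution_zero[OF assms(1) _ this assms(4) _ assms(6)] show ?thesis
    using assms by auto
qed

text \<open>Picard iteration: Banach's fixed point theorem on short pieces, then gluing. The
  induction ranges over all initial values because the second piece starts where the first one
  ends.\<close>

lemma solution_exists_interval:
  assumes "0 \<le> a" "a \<le> b"
  shows "\<exists>x. x a = v \<and> solution_on A a b x"
proof -
  have "\<forall>v. \<exists>x. x a = v \<and> solution_on A a b x"
    using assms
  proof (induction rule: interval_induct)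
    case (trans p q r)
    show ?case
    proof
      fix v
      obtain x where x: "x p = v" "solution_on A p q x" using trans by blast
      obtain y where y: "y q = x q" "solution_on A q r y" using trans by blast
      define z where "z t = (if t \<le> q then x t else y t)" for t
      have "z t = x t" if "t \<in> {p..q}" for t using that by (simp add: z_def)
      moreover have "z t = y t" if "t \<in> {q..r}" for t
        using that y(1) by (cases "t = q") (simp_all add: z_def)
      ultimately have "solution_on A p q z" "solution_on A q r z"
        using x(2) y(2) solution_on_cong[of p q z x A] solution_on_cong[of q r z y A] by blast+
      then have "solution_on A p r z"
        using trans by (blast intro: solution_on_join)
      then show "\<exists>x. x p = v \<and> solution_on A p r x"
        using x(1) trans by (intro exI[of _ z]) (auto simp: z_def)
    qed
  next
    case (small p q)
    show ?case
    proof
      fix v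
      \<comment> \<open>Elements of \<open>bcontfun\<close> are bounded continuous functions on the
        whole line. Clamping time to \<open>{p..q}\<close> makes the Picard operator
        \<open>G\<close> produce such functions while leaving it unchanged on
        \<open>{p..q}\<close>.\<close>
      define cl where "cl t = max p (min q t)" for t
      have cl: "cl t \<in> {p..q}" "t \<in> {p..q} \<Longrightarrow> cl t = t" for t
        using small by (auto simp: cl_def)
      define G where "G x t = v + integral {p..cl t} (\<lambda>s. A s *v x s)"
        for x :: "real \<Rightarrow> real ^ 'n" and t
      have G: "G x \<in> bcontfun" if "continuous_on UNIV x" for x
      proof -
        have x: "continuous_on {p..q} x" using that continuous_on_subset by blast
        have c: "continuous_on {p..q} (\<lambda>t. v + integral {p..t} (\<lambda>s. A s *v x s))"
          using integrable_mult[OF small(1) x]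
          by (intro continuous_intros indefinite_integral_continuous_1)
            (simp add: absolutely_integrable_on_def)
        have "continuous_on UNIV cl"
          unfolding cl_def by (intro continuous_intros)
        then have "continuous_on UNIV (G x)"
          unfolding G_def using cl(1) by (intro continuous_on_compose2[OF c]) auto
        moreover have "bounded (range (G x))"
          by (rule bounded_subset[OF compact_imp_bounded[OF compact_continuous_image[OF c]]])
            (use cl(1) in \<open>auto simp: G_def\<close>)
        ultimately show ?thesis by (simp add: bcontfun_def)
      qed
      define F where "F x = Bcontfun (G (apply_bcontfun x))" for x
      have F: "apply_bcontfun (F x) = G (apply_bcontfun x)" for x
        unfolding F_def using G by (simp add: Bcontfun_inverse)
      have "dist (F x) (F y) \<le> 1/2 * dist x y" for x y
      proof (rule dist_bound)
        fix t
        have sub: "{p..cl t} \<subseteq> {p..q}" using cl(1)[of t] by auto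
        have ix: "(\<lambda>s. A s *v apply_bcontfun x s) integrable_on {p..cl t}" for x
          using integrable_mult[OF small(1)] by (simp add: absolutely_integrable_on_def)
        have "dist (F x t) (F y t)
          = norm (integral {p..cl t} (\<lambda>s. A s *v (apply_bcontfun x s - apply_bcontfun y s)))"
          by (simp add: F G_def dist_norm matrix_vector_mult_diff_distrib integral_diff ix)
        also have "\<dots> \<le> dist x y * integral {p..cl t} (\<lambda>s. norm (A s))"
          using dist_bounded[of x _ y]
          by (intro norm_integral_mult_le small) (auto intro!: continuous_intros simp: dist_norm)
        also have "\<dots> \<le> dist x y * integral {p..q} (\<lambda>s. norm (A s))"
          by (intro mult_left_mono integral_subset_le integrable_norm) (use sub small(1) in auto)
        also have "\<dots> \<le> dist x y * (1/2)"
          using small(3) by (intro mult_left_mono) auto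
        finally show "dist (F x t) (F y t) \<le> 1/2 * dist x y" by simp
      qed
      then obtain x where x: "F x = x"
        using banach_fix_type[of "1/2" F] by auto
      \<comment> \<open>On \<open>{p..q}\<close> clamping is the identity, so there the fixed point
        satisfies the original integral equation.\<close>
      have eq: "apply_bcontfun x t = v + integral {p..t} (\<lambda>s. A s *v apply_bcontfun x s)"
        if "t \<in> {p..q}" for t
      proof -
        have "apply_bcontfun x t = G x t"
          by (rule fun_cong[OF F[of x, unfolded x]])
        then show ?thesis
          using cl(2)[OF that] by (simp add: G_def)
      qed
      have "solution_on A p q x"
        unfolding solution_on_def
      proof
        fix t assume t: "t \<in> {p..q}"
        have "(\<lambda>s. A s *v apply_bcontfun x s) integrable_on {p..t}"
          using integrable_mult[OF small(1)] by (simp add: absolutely_integrable_on_def)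
        then show "((\<lambda>s. A s *v x s) has_integral (x t - x p)) {p..t}"
          using eq[of t] eq[of p] t by (simp add: has_integral_iff)
      qed
      moreover have "x p = v" using eq[of p] small by simp
      ultimately show "\<exists>x. x p = v \<and> solution_on A p q x" by blast
    qed
  qed
  then show ?thesis by blast
qed

lemma network_solution_exists:
  assumes "0 \<le> a"
  shows "\<exists>x. x a = v \<and> network_solution A a x"
proof -
  have "\<forall>b. \<exists>x. a \<le> b \<longrightarrow> x a = v \<and> solution_on A a b x"
    using solution_exists_interval[OF assms] by blast
  from choice[OF this] obtain y
    where y: "\<And>b. a \<le> b \<Longrightarrow> y b a = v" "\<And>b. a \<le> b \<Longrightarrow> solution_on A a b (y b)"
    by blast
  \<comment> \<open>By uniqueness the solutions for different horizons agree where both are defined,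
    so the diagonal \<open>y t t\<close> coincides with \<open>y b\<close> on all of
    \<open>{a..b}\<close>.\<close>
  have eq: "y t t = y b t" if "t \<in> {a..b}" for t b
    by (rule solution_unique[of a t _ _ a]) (use that assms y solution_on_mono[OF y(2)] in auto)
  have "solution_on A a b (\<lambda>t. y t t)" for b
  proof (cases "a \<le> b")
    case True
    then show ?thesis
      using y(2) eq solution_on_cong[of a b "\<lambda>t. y t t" "y b" A] by blast
  qed (simp add: solution_on_def)
  then show ?thesis
    using y(1)[of a] by (intro exI[of _ "\<lambda>t. y t t"]) (simp add: network_solution_iff)
qed

lemma network_solution_unique:
  assumes "0 \<le> a" "network_solution A a x" "network_solution A a y"
    and "a \<le> c" "x c = y c" "a \<le> t"
  shows "x t = y t"
  by (rule solution_unique[of a "max c t" x y c])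
    (use assms in \<open>auto simp: network_solution_iff\<close>)

end

section \<open>The flow and the null space\<close>

context locally_integrable_system
begin

text \<open>At times \<open>t \<ge> 0\<close> the value is independent of the choice, by
  \<open>flow_unique\<close>; at negative times it is arbitrary.\<close>

definition flow :: "real ^ 'n \<Rightarrow> real \<Rightarrow> real ^ 'n" where
  "flow v = (SOME x. x 0 = v \<and> network_solution A 0 x)"

lemma flow: "flow v 0 = v" "network_solution A 0 (flow v)"
  using someI_ex[OF network_solution_exists[of 0 v]] by (simp_all add: flow_def)

lemma flow_unique: "network_solution A 0 x \<Longrightarrow> 0 \<le> t \<Longrightarrow> x t = flow (x 0) t"
  by (rule network_solution_unique[of 0 _ _ 0]) (simp_all add: flow)

lemma network_solution_flow: "0 \<le> a \<Longrightarrow> network_solution A a (flow v)"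
  using flow(2)[of v] by (auto simp: network_solution_iff intro: solution_on_later_start)

lemma linear_flow:
  assumes "0 \<le> t"
  shows "linear (\<lambda>v. flow v t)"
proof -
  have *: "flow (c *\<^sub>R v + d *\<^sub>R w) t = c *\<^sub>R flow v t + d *\<^sub>R flow w t" for c d v w
    using flow_unique[OF network_solution_linear_combination[OF flow(2) flow(2)] assms, of c v d w]
    by (simp add: flow)
  show ?thesis
  proof (rule linearI)
    show "flow (v + w) t = flow v t + flow w t" for v w using *[of 1 v 1 w] by simp
    show "flow (c *\<^sub>R v) t = c *\<^sub>R flow v t" for c v using *[of c v 0 0] by simp
  qed
qed

text \<open>Backward uniqueness: two solutions that meet at time \<open>t\<close> already agree at
  time \<open>0\<close>. In finite dimension this also makes the flow surjective.\<close>

lemma inj_flow: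
  assumes "0 \<le> t"
  shows "inj (\<lambda>v. flow v t)"
proof (rule injI)
  fix v w assume "flow v t = flow w t"
  then have "flow v 0 = flow w 0"
    by (rule network_solution_unique[OF order_refl flow(2) flow(2) assms]) simp
  then show "v = w" by (simp add: flow)
qed

lemma surj_flow: "0 \<le> t \<Longrightarrow> surj (\<lambda>v. flow v t)"
  by (simp add: linear_injective_imp_surjective linear_flow inj_flow)

section \<open>The transition matrix from time \<open>0\<close> expressed by the flow\<close>

lemma fundamental_solution_flow: "fundamental_solution A 0 (\<lambda>t. matrix (\<lambda>v. flow v t))"
  unfolding fundamental_solution_def
proof (intro conjI allI impI)
  show "matrix (\<lambda>v. flow v 0) = mat 1"
    by (simp add: flow matrix_id_mat_1 flip: id_def)
next
  fix t :: real assume t: "0 \<le> t"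
  let ?X = "\<lambda>t. matrix (\<lambda>v. flow v t)"
  show "((\<lambda>s. A s ** ?X s) has_integral (?X t - ?X 0)) {0..t}"
  proof (rule has_integral_componentwise)
    fix b :: "real ^ 'n ^ 'n" assume "b \<in> Basis"
    then obtain i j where b: "b = axis i (axis j 1)"
      by (auto simp: Basis_vec_def)
    \<comment> \<open>The columns of the matrix are the solutions starting at the axis vectors, so
      its entry \<open>(i,j)\<close> is component \<open>i\<close> of the solution from
      \<open>axis j 1\<close>.\<close>
    have "((\<lambda>s. A s *v flow (axis j 1) s) has_integral (flow (axis j 1) t - flow (axis j 1) 0)) {0..t}"
      using flow(2)[of "axis j 1"] t by (simp add: network_solution_def)
    then have "((\<lambda>s. (A s *v flow (axis j 1) s) \<bullet> axis i 1) has_integral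
        ((flow (axis j 1) t - flow (axis j 1) 0) \<bullet> axis i 1)) {0..t}"
      by (rule has_integral_linear[OF _ bounded_linear_inner_left, unfolded o_def])
    then show "((\<lambda>s. (A s ** ?X s) \<bullet> b) has_integral (?X t - ?X 0) \<bullet> b) {0..t}"
      by (simp add: b inner_axis matrix_def matrix_matrix_mult_def matrix_vector_mult_def)
  qed
qed

lemma network_solution_fundamental:
  assumes "fundamental_solution A 0 X"
  shows "network_solution A 0 (\<lambda>t. X t *v v)"
  unfolding network_solution_def
proof (intro allI impI)
  fix t :: real assume "0 \<le> t"
  then have "((\<lambda>s. A s ** X s) has_integral (X t - X 0)) {0..t}"
    using assms unfolding fundamental_solution_def by blast
  moreover have "bounded_linear (\<lambda>M :: real ^ 'n ^ 'n. M *v v)"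
    by (intro linear_conv_bounded_linear[THEN iffD1] linearI)
      (simp_all add: matrix_vector_mult_add_rdistrib scaleR_matrix_vector_assoc)
  ultimately have "((\<lambda>M. M *v v) \<circ> (\<lambda>s. A s ** X s) has_integral ((X t - X 0) *v v)) {0..t}"
    by (rule has_integral_linear)
  then show "((\<lambda>s. A s *v (X s *v v)) has_integral (X t *v v - X 0 *v v)) {0..t}"
    by (simp add: o_def matrix_vector_mul_assoc matrix_vector_mult_diff_rdistrib)
qed

text \<open>Every fundamental solution acts on each vector as the flow, so its value at
  \<open>t\<close> is determined; this resolves the definite description in
  \<open>transition_matrix\<close>.\<close>

lemma transition_matrix_mult:
  assumes "0 \<le> t"
  shows "transition_matrix A t 0 *v v = flow v t"
proof -
  have X: "X t *v v = flow v t" if "fundamental_solution A 0 X" for X v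
    using flow_unique[OF network_solution_fundamental[OF that, of v] assms] that
    by (simp add: fundamental_solution_def)
  let ?F = "\<lambda>t. matrix (\<lambda>v. flow v t)"
  have "transition_matrix A t 0 = ?F t"
    unfolding transition_matrix_def
  proof (rule the_equality)
    show "\<exists>X. fundamental_solution A 0 X \<and> X t = ?F t"
      using fundamental_solution_flow by blast
  next
    fix M assume "\<exists>X. fundamental_solution A 0 X \<and> X t = M"
    then show "M = ?F t"
      using X X[OF fundamental_solution_flow] by (auto simp: matrix_eq)
  qed
  then show ?thesis
    using X[OF fundamental_solution_flow] by simp
qed

section \<open>The null space at time \<open>0\<close> and its transport by the flow\<close>

lemma null_at_zero: "null_at A 0 = {v. (flow v \<longlongrightarrow> 0) at_top}"
  unfolding null_at_def
proof (intro Collect_cong tendsto_cong)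
  show "\<forall>\<^sub>F t in at_top. transition_matrix A t 0 *v v = flow v t" for v
    using eventually_ge_at_top[of 0] by eventually_elim (rule transition_matrix_mult)
qed

lemma subspace_null_at_zero: "subspace (null_at A 0)"
  unfolding subspace_def
proof (intro conjI ballI allI)
  \<comment> \<open>Linearity of the flow is available at times \<open>t \<ge> 0\<close>, hence
    eventually, which is enough for limits.\<close>
  have ev: "\<forall>\<^sub>F t in at_top. linear (\<lambda>v. flow v t)"
    using eventually_ge_at_top[of 0] by eventually_elim (rule linear_flow)
  have "\<forall>\<^sub>F t in at_top. flow 0 t = 0"
    using ev by eventually_elim (rule linear_0)
  then show "0 \<in> null_at A 0"
    by (simp add: null_at_zero tendsto_eventually)
  show "v + w \<in> null_at A 0" if "v \<in> null_at A 0" "w \<in> null_at A 0" for v w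
  proof -
    have "((\<lambda>t. flow v t + flow w t) \<longlongrightarrow> 0) at_top"
      using that by (auto simp: null_at_zero intro: tendsto_add_zero)
    moreover have "\<forall>\<^sub>F t in at_top. flow (v + w) t = flow v t + flow w t"
      using ev by eventually_elim (rule linear_add)
    ultimately show ?thesis
      by (simp add: null_at_zero tendsto_cong)
  qed
  show "c *\<^sub>R v \<in> null_at A 0" if "v \<in> null_at A 0" for c v
  proof -
    have "((\<lambda>t. c *\<^sub>R flow v t) \<longlongrightarrow> c *\<^sub>R 0) at_top"
      by (intro tendsto_intros) (use that in \<open>simp add: null_at_zero\<close>)
    moreover have "\<forall>\<^sub>F t in at_top. flow (c *\<^sub>R v) t = c *\<^sub>R flow v t"
      using ev by eventually_elim (rule linear_cmul)
    ultimately show ?thesis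
      by (simp add: null_at_zero tendsto_cong)
  qed
qed

text \<open>Since the flow up to time \<open>a\<close> is surjective, every solution starting at
  \<open>a\<close> extends back to time \<open>0\<close>, and the extension has the same limit
  behaviour.\<close>

lemma vanishing_solution_iff:
  assumes "0 \<le> a"
  shows "(\<exists>x. network_solution A a x \<and> x a = v \<and> (x \<longlongrightarrow> 0) at_top)
    \<longleftrightarrow> v \<in> (\<lambda>u. flow u a) ` null_at A 0"
proof
  assume "\<exists>x. network_solution A a x \<and> x a = v \<and> (x \<longlongrightarrow> 0) at_top"
  then obtain x where x: "network_solution A a x" "x a = v" "(x \<longlongrightarrow> 0) at_top" by blast
  obtain u where u: "v = flow u a"
    using surj_flow[OF assms] by (metis surjD)
  have "\<forall>\<^sub>F t in at_top. x t = flow u t"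
    using eventually_ge_at_top[of a]
  proof eventually_elim
    case (elim t)
    show ?case
      by (rule network_solution_unique[OF assms x(1) network_solution_flow[OF assms] order_refl])
        (use elim x(2) u in auto)
  qed
  then have "u \<in> null_at A 0"
    using x(3) by (simp add: null_at_zero tendsto_cong)
  then show "v \<in> (\<lambda>u. flow u a) ` null_at A 0"
    using u by blast
next
  assume "v \<in> (\<lambda>u. flow u a) ` null_at A 0"
  then show "\<exists>x. network_solution A a x \<and> x a = v \<and> (x \<longlongrightarrow> 0) at_top"
    using network_solution_flow[OF assms] by (auto simp: null_at_zero)
qed

lemma dim_flow_null_at: "0 \<le> a \<Longrightarrow> dim ((\<lambda>u. flow u a) ` null_at A 0) = chain_nullity A"
  unfolding chain_nullity_def
  by (intro dim_image_eq linear_flow inj_on_subset[OF inj_flow]) auto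

end

section \<open>Coalitions of a chain\<close>

lemma locally_integrable_system_chain:
  fixes A :: "real \<Rightarrow> real ^ 'n ^ 'n"
  assumes "ct_chain A"
  shows "locally_integrable_system A"
proof
  fix T :: real assume T: "0 \<le> T"
  show "A absolutely_integrable_on {0..T}"
  proof (rule absolutely_integrable_componentwise)
    fix b :: "real ^ 'n ^ 'n" assume "b \<in> Basis"
    then obtain i j where "b = axis i (axis j 1)"
      by (auto simp: Basis_vec_def)
    then show "(\<lambda>t. A t \<bullet> b) absolutely_integrable_on {0..T}"
      using assms T by (simp add: inner_axis ct_chain_def)
  qed
qed

lemma consensus_network_solution:
  assumes "ct_chain A" "0 \<le> a"
  shows "network_solution A a (\<lambda>_. \<chi> i. c)"
proof -
  have "A s *v (\<chi> i. c) = 0" if "0 \<le> s" for s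
    using assms(1) that
    by (simp add: ct_chain_def matrix_vector_mult_def vec_eq_iff flip: sum_distrib_right)
  then show ?thesis
    using assms(2) by (auto simp: network_solution_def intro!: has_integral_is_0)
qed

text \<open>Adding a consensus vector turns a solution tending to \<open>0\<close> into one tending
  to that vector, so the target \<open>0\<close> stands for all targets once the prescribed values
  are shifted accordingly.\<close>

lemma is_EGC_iff:
  fixes A :: "real \<Rightarrow> real ^ 'n ^ 'n"
  assumes "ct_chain A" "0 \<le> t0"
  shows "is_EGC A t0 S \<longleftrightarrow> (\<forall>y. \<exists>x. network_solution A t0 x \<and> (x \<longlongrightarrow> 0) at_top \<and>
    (\<forall>i. i \<notin> S \<longrightarrow> x t0 $ i = y $ i))"
proof
  assume "is_EGC A t0 S"
  then have "\<exists>x. network_solution A t0 x \<and> (\<forall>i. i \<notin> S \<longrightarrow> x t0 $ i = y $ i) \<and>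
      (x \<longlongrightarrow> (\<chi> i. 0)) at_top" for y
    unfolding is_EGC_def by blast
  then show "\<forall>y. \<exists>x. network_solution A t0 x \<and> (x \<longlongrightarrow> 0) at_top \<and>
      (\<forall>i. i \<notin> S \<longrightarrow> x t0 $ i = y $ i)"
    unfolding zero_vec_def by blast
next
  assume R: "\<forall>y. \<exists>x. network_solution A t0 x \<and> (x \<longlongrightarrow> 0) at_top \<and>
      (\<forall>i. i \<notin> S \<longrightarrow> x t0 $ i = y $ i)"
  show "is_EGC A t0 S"
    unfolding is_EGC_def
  proof (intro allI)
    fix c :: real and y :: "real ^ 'n"
    let ?c = "(\<chi> i. c) :: real ^ 'n"
    obtain x where x: "network_solution A t0 x" "(x \<longlongrightarrow> 0) at_top"
        "\<And>i. i \<notin> S \<Longrightarrow> x t0 $ i = (y - ?c) $ i"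
      using R[rule_format, of "y - ?c"] by blast
    have "network_solution A t0 (\<lambda>t. x t + ?c)"
      using network_solution_linear_combination[OF x(1) consensus_network_solution[OF assms, of c],
          of 1 1] by simp
    moreover have "((\<lambda>t. x t + ?c) \<longlongrightarrow> ?c) at_top"
      using tendsto_add[OF x(2) tendsto_const[of ?c]] by simp
    ultimately show "\<exists>x. network_solution A t0 x \<and> (\<forall>i. i \<notin> S \<longrightarrow> x t0 $ i = y $ i) \<and>
        (x \<longlongrightarrow> (\<chi> i. c)) at_top"
      using x(3) by (intro exI[of _ "\<lambda>t. x t + ?c"]) simp
  qed
qed

theorem theorem1:
  fixes A :: "real \<Rightarrow> real ^ 'n ^ 'n" and t0 :: real
  assumes "ct_chain A" and "t0 \<ge> 0"
  shows "(\<exists>S. is_EGC A t0 S \<and> card S = chain_rank A) \<and>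
         (\<forall>S. is_EGC A t0 S \<longrightarrow> chain_rank A \<le> card S)"
proof -
  interpret locally_integrable_system A
    by (rule locally_integrable_system_chain) fact
  define V where "V = (\<lambda>u. flow u t0) ` null_at A 0"
  have EGC: "is_EGC A t0 S \<longleftrightarrow> (\<forall>y. \<exists>v\<in>V. \<forall>i. i \<notin> S \<longrightarrow> v $ i = y $ i)" for S
    unfolding is_EGC_iff[OF assms] V_def Bex_def vanishing_solution_iff[OF assms(2), symmetric]
    by blast
  \<comment> \<open>The rank refers to time \<open>0\<close> and \<open>V\<close> to time
    \<open>t0\<close>; the injective linear flow between them preserves the dimension.\<close>
  have rank: "chain_rank A = CARD('n) - dim V"
    using assms(2) by (simp add: chain_rank_def V_def dim_flow_null_at)
  have "subspace V"
    unfolding V_def by (intro linear_subspace_image linear_flow subspace_null_at_zero assms)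
  then obtain S where "card S = CARD('n) - dim V" "is_EGC A t0 S"
    unfolding EGC by (metis complement_coordinates_exist)
  moreover have "chain_rank A \<le> card S" if "is_EGC A t0 S" for S
    using that dim_complement_coordinates_le[of V S] by (simp add: EGC rank)
  ultimately show ?thesis
    by (auto simp: rank)
qed

end
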